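(* There is a one-to-one correspondence between skeletal $3$-Lie $2$-algebras and quadruples $((\mathfrak g,[\cdot,\cdot,\cdot]),V,\rho,\Theta)$, where $(\mathfrak g,[\cdot,\cdot,\cdot])$ is a $3$-Lie algebra, $V$ is a vector space, $\rho$ is a representation of $\mathfrak g$ on $V$, and $\Theta$ is a $3$-cocycle on $\mathfrak g$ with values in $V$.
   Context: Vector spaces are over a fixed base field. A $3$-Lie algebra is a vector space $\mathfrak g$ with a trilinear fully skew-symmetric map $[\cdot,\cdot,\cdot]:\wedge^3\mathfrak g\to\mathfrak g$ such that $[x_1,x_2,[x_3,x_4,x_5]]=[[x_1,x_2,x_3],x_4,x_5]+[x_3,[x_1,x_2,x_4],x_5]+[x_3,x_4,[x_1,x_2,x_5]]$ for all $x_i\in\mathfrak g$. On $\wedge^2\mathfrak g$ put $[x_1\wedge x_2,y_1\wedge y_2]_{\mathrm F}=[x_1,x_2,y_1]\wedge y_2+y_1\wedge[x_1,x_2,y_2]$; for $\mathfrak X=x\wedge y$ write $[\mathfrak X,z]=[x,y,z]$. A representation of $\mathfrak g$ on $V$ is a linear map $\rho:\wedge^2\mathfrak g\to\mathfrak{gl}(V)$ with $[\rho(\mathfrak X),\rho(\mathfrak Y)]=\rho([\mathfrak X,\mathfrak Y]_{\mathrm F})$ for all $\mathfrak X,\mathfrak Y\in\wedge^2\mathfrak g$ and $\rho(x,[y_1,y_2,y_3])=\rho(y_2,y_3)\rho(x,y_1)-\rho(y_1,y_3)\rho(x,y_2)+\rho(y_1,y_2)\rho(x,y_3)$ for all $x,y_i\in\mathfrak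 g$. A $p$-cochain with coefficients in $(V;\rho)$ is a linear map $\alpha^p:\wedge^2\mathfrak g\otimes\cdots\otimes\wedge^2\mathfrak g\wedge\mathfrak g\to V$ with $p-1$ factors $\wedge^2\mathfrak g$ (for $p\ge2$ the domain is $(\wedge^2\mathfrak g)^{\otimes(p-2)}\otimes\wedge^3\mathfrak g$; so a $3$-cochain is a linear map $\wedge^2\mathfrak g\otimes\wedge^3\mathfrak g\to V$). With $\mathfrak X_i=x_i\wedge y_i$, the coboundary operator is $$(\delta\alpha^p)(\mathfrak X_1,\ldots,\mathfrak X_p,z)=\sum_{1\le j<k\le p}(-1)^j\alpha^p(\mathfrak X_1,\ldots,\hat{\mathfrak X}_j,\ldots,\mathfrak X_{k-1},[\mathfrak X_j,\mathfrak X_k]_{\mathrm F},\mathfrak X_{k+1},\ldots,\mathfrak X_p,z)$$ $$+\sum_{j=1}^p(-1)^j\alpha^p(\mathfrak X_1,\ldots,\hat{\mathfrak X}_j,\ldots,\mathfrak X_p,[\mathfrak X_j,z])+\sum_{j=1}^p(-1)^{j+1}\rho(\mathfrak X_j)\alpha^p(\mathfrak X_1,\ldots,\hat{\mathfrak X}_j,\ldots,\mathfrak X_p,z)$$ $$+(-1)^{p+1}\big(\rho(y_p,z)\alpha^p(\mathfrak X_1,\ldots,\mathfrak X_{p-1},x_p)+\rho(z,x_p)\alpha^p(\mathfrak X_1,\ldots,\mathfrak X_{p-1},y_p)\big).$$ A $3$-cocycle is a $3$-cochain $\Theta$ with $\delta\Theta=0$. A $3$-Lie $2$-algebra here means a $2$-term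 $3$-$Lie_\infty$-algebra $(V_1,V_0,\mathrm d,l_3,l_5)$: a complex of vector spaces $V_1\xrightarrow{\mathrm d}V_0$; completely skew-symmetric trilinear maps $l_3:V_i\times V_j\times V_k\to V_{i+j+k}$, $0\le i+j+k\le1$; and a multilinear map $l_5:(V_0\wedge V_0)\otimes(V_0\wedge V_0\wedge V_0)\to V_1$, such that for all $x,y,x_i\in V_0$, $f,g,h\in V_1$: (a) $\mathrm d l_3(x,y,f)=l_3(x,y,\mathrm df)$; (b) $l_3(f,g,h)=0$ and $l_3(f,g,x)=0$; (c) $l_3(\mathrm df,g,x)=l_3(f,\mathrm dg,x)$; (d) $\mathrm d l_5(x_1,x_2,x_3,x_4,x_5)=-l_3(x_1,x_2,l_3(x_3,x_4,x_5))+l_3(x_3,l_3(x_1,x_2,x_4),x_5)+l_3(l_3(x_1,x_2,x_3),x_4,x_5)+l_3(x_3,x_4,l_3(x_1,x_2,x_5))$; (e) $l_5(\mathrm df,x_2,x_3,x_4,x_5)=-l_3(f,x_2,l_3(x_3,x_4,x_5))+l_3(x_3,l_3(f,x_2,x_4),x_5)+l_3(l_3(f,x_2,x_3),x_4,x_5)+l_3(x_3,x_4,l_3(f,x_2,x_5))$; (f) $l_5(x_1,x_2,\mathrm df,x_4,x_5)=-l_3(x_1,x_2,l_3(f,x_4,x_5))+l_3(f,l_3(x_1,x_2,x_4),x_5)+l_3(l_3(x_1,x_2,f),x_4,x_5)+l_3(f,x_4,l_3(x_1,x_2,x_5))$; (g) $l_3(l_5(x_1,x_2,x_3,x_4,x_5),x_6,x_7)+l_3(x_5,l_5(x_1,x_2,x_3,x_4,x_6),x_7)+l_3(x_1,x_2,l_5(x_3,x_4,x_5,x_6,x_7))+l_3(x_5,x_6,l_5(x_1,x_2,x_3,x_4,x_7))+l_5(x_1,x_2,l_3(x_3,x_4,x_5),x_6,x_7)+l_5(x_1,x_2,x_5,l_3(x_3,x_4,x_6),x_7)+l_5(x_1,x_2,x_5,x_6,l_3(x_3,x_4,x_7))$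 $=l_3(x_3,x_4,l_5(x_1,x_2,x_5,x_6,x_7))+l_5(l_3(x_1,x_2,x_3),x_4,x_5,x_6,x_7)+l_5(x_3,l_3(x_1,x_2,x_4),x_5,x_6,x_7)+l_5(x_3,x_4,l_3(x_1,x_2,x_5),x_6,x_7)+l_5(x_3,x_4,x_5,l_3(x_1,x_2,x_6),x_7)+l_5(x_1,x_2,x_3,x_4,l_3(x_5,x_6,x_7))+l_5(x_3,x_4,x_5,x_6,l_3(x_1,x_2,x_7))$. It is called skeletal if $\mathrm d=0$. *)

theory Defs
  imports "HOL-Analysis.Product_Vector"
begin

text \<open>
  Vector spaces are given by their scalar multiplication: \<open>vector_space s\<close> with
  \<open>s :: 'k \<Rightarrow> 'a \<Rightarrow> 'a\<close> over a field \<open>'k\<close> of arbitrary characteristic, the additive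
  group being that of the type \<open>'a\<close>.

  A linear map out of an exterior power is a multilinear map that vanishes whenever two
  arguments in the same exterior factor coincide. This implies the sign rule under
  transpositions, and is equivalent to it if the characteristic is not 2. ``Skew-symmetric''
  is read in this sense. Identities that are linear in elements of the second exterior power
  are stated on decomposable elements, encoded as pairs.
\<close>

definition alternating2 ::
  "('k::field \<Rightarrow> 'a::ab_group_add \<Rightarrow> 'a) \<Rightarrow> ('k \<Rightarrow> 'b::ab_group_add \<Rightarrow> 'b) \<Rightarrow> ('a \<Rightarrow> 'a \<Rightarrow> 'b) \<Rightarrow> bool"
  where "alternating2 s t \<phi> \<longleftrightarrow>
    (\<forall>y. Vector_Spaces.linear s t (\<lambda>x. \<phi> x y)) \<and>
    (\<forall>x. Vector_Spaces.linear s t (\<lambda>y. \<phi> x y)) \<and>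
    (\<forall>x. \<phi> x x = 0)"

definition alternating3 ::
  "('k::field \<Rightarrow> 'a::ab_group_add \<Rightarrow> 'a) \<Rightarrow> ('k \<Rightarrow> 'b::ab_group_add \<Rightarrow> 'b) \<Rightarrow> ('a \<Rightarrow> 'a \<Rightarrow> 'a \<Rightarrow> 'b) \<Rightarrow> bool"
  where "alternating3 s t \<phi> \<longleftrightarrow>
    (\<forall>y z. Vector_Spaces.linear s t (\<lambda>x. \<phi> x y z)) \<and>
    (\<forall>x z. Vector_Spaces.linear s t (\<lambda>y. \<phi> x y z)) \<and>
    (\<forall>x y. Vector_Spaces.linear s t (\<lambda>z. \<phi> x y z)) \<and>
    (\<forall>x y. \<phi> x x y = 0 \<and> \<phi> x y y = 0 \<and> \<phi> x y x = 0)"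

text \<open>Linear maps on the tensor product of the second and the third exterior power.\<close>

definition wedge2_wedge3_map ::
  "('k::field \<Rightarrow> 'a::ab_group_add \<Rightarrow> 'a) \<Rightarrow> ('k \<Rightarrow> 'b::ab_group_add \<Rightarrow> 'b) \<Rightarrow>
    ('a \<Rightarrow> 'a \<Rightarrow> 'a \<Rightarrow> 'a \<Rightarrow> 'a \<Rightarrow> 'b) \<Rightarrow> bool"
  where "wedge2_wedge3_map s t \<phi> \<longleftrightarrow>
    (\<forall>x3 x4 x5. alternating2 s t (\<lambda>x1 x2. \<phi> x1 x2 x3 x4 x5)) \<and>
    (\<forall>x1 x2. alternating3 s t (\<lambda>x3 x4 x5. \<phi> x1 x2 x3 x4 x5))"


section \<open>3-Lie algebras, representations and cocycles\<close>

locale three_lie_algebra = vector_space s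
  for s :: "'k::field \<Rightarrow> 'a::ab_group_add \<Rightarrow> 'a" +
  fixes br :: "'a \<Rightarrow> 'a \<Rightarrow> 'a \<Rightarrow> 'a"
  assumes alternating: "alternating3 s s br"
    and fundamental_identity:
      "br x1 x2 (br x3 x4 x5) = br (br x1 x2 x3) x4 x5 + br x3 (br x1 x2 x4) x5 + br x3 x4 (br x1 x2 x5)"

text \<open>
  The bracket on the second exterior power, for decomposable arguments. The value is the sum
  of the decomposable elements in the resulting list.
\<close>

fun bracket_F :: "('a \<Rightarrow> 'a \<Rightarrow> 'a \<Rightarrow> 'a) \<Rightarrow> 'a \<times> 'a \<Rightarrow> 'a \<times> 'a \<Rightarrow> ('a \<times> 'a) list"
  where "bracket_F br (x1, x2) (y1, y2) = [(br x1 x2 y1, y2), (y1, br x1 x2 y2)]"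

locale three_lie_representation =
  three_lie_algebra s br + V: vector_space t
  for s :: "'k::field \<Rightarrow> 'a::ab_group_add \<Rightarrow> 'a" and br :: "'a \<Rightarrow> 'a \<Rightarrow> 'a \<Rightarrow> 'a"
    and t :: "'k \<Rightarrow> 'b::ab_group_add \<Rightarrow> 'b" +
  fixes \<rho> :: "'a \<Rightarrow> 'a \<Rightarrow> 'b \<Rightarrow> 'b"
  assumes rho_endo: "Vector_Spaces.linear t t (\<rho> x y)"
    and rho_alternating: "alternating2 s t (\<lambda>x y. \<rho> x y v)"
    and rho_commutator:
      "\<rho> x1 x2 (\<rho> y1 y2 v) - \<rho> y1 y2 (\<rho> x1 x2 v) =
        (\<Sum>(u, w)\<leftarrow>bracket_F br (x1, x2) (y1, y2). \<rho> u w v)"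
    and rho_bracket:
      "\<rho> x (br y1 y2 y3) v =
        \<rho> y2 y3 (\<rho> x y1 v) - \<rho> y1 y3 (\<rho> x y2 v) + \<rho> y1 y2 (\<rho> x y3 v)"

text \<open>
  The coboundary of a \<open>p\<close>-cochain \<open>\<alpha>\<close>, where \<open>\<alpha> Xs z\<close> is the value at a list \<open>Xs\<close> of
  \<open>p - 1\<close> decomposable elements and a vector \<open>z\<close>. The indices \<open>j\<close> and \<open>k\<close> start
  at 1, list positions at 0.
\<close>

definition omit :: "nat \<Rightarrow> 'c list \<Rightarrow> 'c list"
  where "omit j Xs = take (j - 1) Xs @ drop j Xs"

definition coboundary ::
  "('a \<Rightarrow> 'a \<Rightarrow> 'a \<Rightarrow> 'a) \<Rightarrow> ('k::field \<Rightarrow> 'b::ab_group_add \<Rightarrow> 'b) \<Rightarrow> ('a \<Rightarrow> 'a \<Rightarrow> 'b \<Rightarrow> 'b) \<Rightarrow>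
    nat \<Rightarrow> (('a \<times> 'a) list \<Rightarrow> 'a \<Rightarrow> 'b) \<Rightarrow> ('a \<times> 'a) list \<Rightarrow> 'a \<Rightarrow> 'b"
  where "coboundary br t \<rho> p \<alpha> Xs z =
    (let X = (\<lambda>j. Xs ! (j - 1)); x = (\<lambda>j. fst (X j)); y = (\<lambda>j. snd (X j)) in
      (\<Sum>k = 1..p. \<Sum>j = 1..<k.
        t ((-1) ^ j) (\<Sum>U\<leftarrow>bracket_F br (X j) (X k). \<alpha> (omit j (Xs[k - 1 := U])) z))
      + (\<Sum>j = 1..p. t ((-1) ^ j) (\<alpha> (omit j Xs) (br (x j) (y j) z)))
      + (\<Sum>j = 1..p. t ((-1) ^ (j + 1)) (\<rho> (x j) (y j) (\<alpha> (omit j Xs) z)))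
      + t ((-1) ^ (p + 1))
          (\<rho> (y p) z (\<alpha> (take (p - 1) Xs) (x p)) + \<rho> z (x p) (\<alpha> (take (p - 1) Xs) (y p))))"

text \<open>
  A 3-cochain is curried, \<open>\<Theta> x1 x2 x3 x4 x5\<close>. The following view of it as a function of a
  list of pairs and a vector is only relevant for lists of length 2.
\<close>

fun list_form :: "('a \<Rightarrow> 'a \<Rightarrow> 'a \<Rightarrow> 'a \<Rightarrow> 'a \<Rightarrow> 'b::zero) \<Rightarrow> ('a \<times> 'a) list \<Rightarrow> 'a \<Rightarrow> 'b"
  where
    "list_form \<Theta> [(x1, x2), (x3, x4)] x5 = \<Theta> x1 x2 x3 x4 x5"
  | "list_form \<Theta> _ _ = 0"

definition three_cocycle ::
  "('k::field \<Rightarrow> 'a::ab_group_add \<Rightarrow> 'a) \<Rightarrow> ('a \<Rightarrow> 'a \<Rightarrow> 'a \<Rightarrow> 'a) \<Rightarrow>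
    ('k \<Rightarrow> 'b::ab_group_add \<Rightarrow> 'b) \<Rightarrow> ('a \<Rightarrow> 'a \<Rightarrow> 'b \<Rightarrow> 'b) \<Rightarrow>
    ('a \<Rightarrow> 'a \<Rightarrow> 'a \<Rightarrow> 'a \<Rightarrow> 'a \<Rightarrow> 'b) \<Rightarrow> bool"
  where "three_cocycle s br t \<rho> \<Theta> \<longleftrightarrow>
    wedge2_wedge3_map s t \<Theta> \<and>
    (\<forall>X1 X2 X3 z. coboundary br t \<rho> 3 (list_form \<Theta>) [X1, X2, X3] z = 0)"


section \<open>3-Lie 2-algebras\<close>

text \<open>
  The maps \<open>l3\<close> on the various \<open>V\<^sub>i \<times> V\<^sub>j \<times> V\<^sub>k\<close> are assembled into one
  map on the direct sum of \<open>V\<^sub>0\<close> and \<open>V\<^sub>1\<close>, which is the product type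
  \<open>'a \<times> 'b\<close>. The index of a component records the degrees of the arguments.
\<close>

locale graded_bracket =
  fixes l3 :: "'a::ab_group_add \<times> 'b::ab_group_add \<Rightarrow> 'a \<times> 'b \<Rightarrow> 'a \<times> 'b \<Rightarrow> 'a \<times> 'b"
begin

abbreviation "l000 x y z \<equiv> fst (l3 (x, 0) (y, 0) (z, 0))"
abbreviation "l001 x y f \<equiv> snd (l3 (x, 0) (y, 0) (0, f))"
abbreviation "l010 x f y \<equiv> snd (l3 (x, 0) (0, f) (y, 0))"
abbreviation "l100 f x y \<equiv> snd (l3 (0, f) (x, 0) (y, 0))"

end

locale three_lie_2_algebra =
  V1: vector_space s1 + V0: vector_space s0 + graded_bracket l3
  for s1 :: "'k::field \<Rightarrow> 'b::ab_group_add \<Rightarrow> 'b"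
    and s0 :: "'k \<Rightarrow> 'a::ab_group_add \<Rightarrow> 'a"
    and d :: "'b \<Rightarrow> 'a"
    and l3 :: "'a \<times> 'b \<Rightarrow> 'a \<times> 'b \<Rightarrow> 'a \<times> 'b \<Rightarrow> 'a \<times> 'b"
    and l5 :: "'a \<Rightarrow> 'a \<Rightarrow> 'a \<Rightarrow> 'a \<Rightarrow> 'a \<Rightarrow> 'b" +
  assumes d_linear: "Vector_Spaces.linear s1 s0 d"
    and l3_alternating: "alternating3 (module_prod.scale s0 s1) (module_prod.scale s0 s1) l3"
    and l3_degree0: "snd (l3 (x, 0) (y, 0) (z, 0)) = 0"
    and l3_degree1: "fst (l3 (x, 0) (y, 0) (0, f)) = 0"
    and l5_wedge: "wedge2_wedge3_map s0 s1 l5"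
    and d_l3: "d (l001 x y f) = l000 x y (d f)"
    and l3_degree2: "l3 (0, f) (0, g) (0, h) = 0" "l3 (0, f) (0, g) (x, 0) = 0"
    and l3_d: "l010 (d f) g x = l100 f (d g) x"
    and d_l5: "d (l5 x1 x2 x3 x4 x5) =
      - l000 x1 x2 (l000 x3 x4 x5) + l000 x3 (l000 x1 x2 x4) x5
      + l000 (l000 x1 x2 x3) x4 x5 + l000 x3 x4 (l000 x1 x2 x5)"
    and l5_d_first: "l5 (d f) x2 x3 x4 x5 =
      - l100 f x2 (l000 x3 x4 x5) + l010 x3 (l100 f x2 x4) x5
      + l100 (l100 f x2 x3) x4 x5 + l001 x3 x4 (l100 f x2 x5)"
    and l5_d_third: "l5 x1 x2 (d f) x4 x5 =
      - l001 x1 x2 (l100 f x4 x5) + l100 f (l000 x1 x2 x4) x5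
      + l100 (l001 x1 x2 f) x4 x5 + l100 f x4 (l000 x1 x2 x5)"
    and l5_coherence:
      "l100 (l5 x1 x2 x3 x4 x5) x6 x7 + l010 x5 (l5 x1 x2 x3 x4 x6) x7
        + l001 x1 x2 (l5 x3 x4 x5 x6 x7) + l001 x5 x6 (l5 x1 x2 x3 x4 x7)
        + l5 x1 x2 (l000 x3 x4 x5) x6 x7 + l5 x1 x2 x5 (l000 x3 x4 x6) x7
        + l5 x1 x2 x5 x6 (l000 x3 x4 x7)
      = l001 x3 x4 (l5 x1 x2 x5 x6 x7)
        + l5 (l000 x1 x2 x3) x4 x5 x6 x7 + l5 x3 (l000 x1 x2 x4) x5 x6 x7
        + l5 x3 x4 (l000 x1 x2 x5) x6 x7 + l5 x3 x4 x5 (l000 x1 x2 x6) x7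
        + l5 x1 x2 x3 x4 (l000 x5 x6 x7) + l5 x3 x4 x5 x6 (l000 x1 x2 x7)"

locale skeletal_three_lie_2_algebra = three_lie_2_algebra +
  assumes skeletal: "d f = 0"

text \<open>
  The correspondence takes \<open>\<gg> = V\<^sub>0\<close> with the bracket \<open>l3\<close>, \<open>V = V\<^sub>1\<close>,
  \<open>\<rho>(x, y) f = l3(x, y, f)\<close> and \<open>\<Theta> = l5\<close>.
\<close>

fun quadruple_of ::
  "('k::field \<Rightarrow> 'b::ab_group_add \<Rightarrow> 'b) \<times> ('k \<Rightarrow> 'a::ab_group_add \<Rightarrow> 'a) \<times> ('b \<Rightarrow> 'a)
    \<times> ('a \<times> 'b \<Rightarrow> 'a \<times> 'b \<Rightarrow> 'a \<times> 'b \<Rightarrow> 'a \<times> 'b) \<times> ('a \<Rightarrow> 'a \<Rightarrow> 'a \<Rightarrow> 'a \<Rightarrow> 'a \<Rightarrow> 'b)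
   \<Rightarrow> (('k \<Rightarrow> 'a \<Rightarrow> 'a) \<times> ('a \<Rightarrow> 'a \<Rightarrow> 'a \<Rightarrow> 'a)) \<times> ('k \<Rightarrow> 'b \<Rightarrow> 'b)
    \<times> ('a \<Rightarrow> 'a \<Rightarrow> 'b \<Rightarrow> 'b) \<times> ('a \<Rightarrow> 'a \<Rightarrow> 'a \<Rightarrow> 'a \<Rightarrow> 'a \<Rightarrow> 'b)"
  where "quadruple_of (s1, s0, d, l3, l5) =
    ((s0, graded_bracket.l000 l3), s1, graded_bracket.l001 l3, l5)"

end

theory Submission
  imports Defs
begin

text \<open>
  A skew-symmetric bracket of degree 0 on \<open>V\<^sub>0 \<oplus> V\<^sub>1\<close> that vanishes on two elements of
  \<open>V\<^sub>1\<close> is determined by its restrictions \<open>br\<close> to \<open>V\<^sub>0\<close> and \<open>\<rho>\<close> to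
  \<open>V\<^sub>0 \<times> V\<^sub>0 \<times> V\<^sub>1\<close>; it is the semidirect product bracket built from them. With
  \<open>d = 0\<close>, axiom (d) is the fundamental identity of \<open>br\<close>, (e) and (f) are the two
  conditions on a representation, and (g) is \<open>\<delta> l\<^sub>5 = 0\<close> written out.
\<close>

section \<open>Alternating maps and the coboundary of a 3-cochain\<close>

lemma linear_zero: "Vector_Spaces.linear s t f \<Longrightarrow> f 0 = 0"
  unfolding linear_iff_module_hom by (rule module_hom.zero)

text \<open>Polarization: of the four terms of \<open>\<phi> (x + y) (x + y) = 0\<close> only the
  two mixed ones survive, in every characteristic.\<close>

lemma alternating2_swap:
  assumes "alternating2 s t \<phi>"
  shows "\<phi> y x = - \<phi> x y"
proof -
  have add: "\<phi> (u + v) w = \<phi> u w + \<phi> v w" "\<phi> w (u + v) = \<phi> w u + \<phi> w v"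
    and diag: "\<phi> u u = 0" for u v w
    using assms by (simp_all add: alternating2_def Vector_Spaces.linear_iff)
  have "\<phi> (x + y) (x + y) = \<phi> y x + \<phi> x y"
    unfolding add by (simp add: diag)
  then show ?thesis
    by (simp add: diag eq_neg_iff_add_eq_0)
qed

lemma
  assumes "alternating3 s t \<phi>"
  shows alternating3_add:
      "\<phi> (x + x') y z = \<phi> x y z + \<phi> x' y z"
      "\<phi> x (y + y') z = \<phi> x y z + \<phi> x y' z"
      "\<phi> x y (z + z') = \<phi> x y z + \<phi> x y z'"
    and alternating3_scale:
      "\<phi> (s c x) y z = t c (\<phi> x y z)"
      "\<phi> x (s c y) z = t c (\<phi> x y z)"
      "\<phi> x y (s c z) = t c (\<phi> x y z)"
    and alternating3_diag: "\<phi> x x y = 0" "\<phi> x y y = 0" "\<phi> x y x = 0"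
  using assms by (simp_all add: alternating3_def Vector_Spaces.linear_iff)

text \<open>Freezing one argument leaves an \<open>alternating2\<close> map, so polarization
  applies.\<close>

lemma alternating3_swap:
  assumes "alternating3 s t \<phi>"
  shows "\<phi> y x z = - \<phi> x y z" and "\<phi> x z y = - \<phi> x y z"
proof -
  have "alternating2 s t (\<lambda>x y. \<phi> x y z)" "alternating2 s t (\<phi> x)"
    using assms by (simp_all add: alternating2_def alternating3_def)
  from this[THEN alternating2_swap] show "\<phi> y x z = - \<phi> x y z" "\<phi> x z y = - \<phi> x y z" .
qed

text \<open>For \<open>d = 0\<close> these are the left-hand sides of \<open>l5_d_first\<close> and
  \<open>l5_d_third\<close>; their vanishing turns the two axioms into the conditions on a
  representation.\<close>

lemma wedge2_wedge3_map_zero: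
  assumes "wedge2_wedge3_map s t \<phi>"
  shows "\<phi> 0 x2 x3 x4 x5 = 0" and "\<phi> x1 x2 0 x4 x5 = 0"
proof -
  have "Vector_Spaces.linear s t (\<lambda>x. \<phi> x x2 x3 x4 x5)"
    "Vector_Spaces.linear s t (\<lambda>x. \<phi> x1 x2 x x4 x5)"
    using assms by (simp_all add: wedge2_wedge3_map_def alternating2_def alternating3_def)
  then show "\<phi> 0 x2 x3 x4 x5 = 0" "\<phi> x1 x2 0 x4 x5 = 0"
    by (auto dest: linear_zero)
qed

text \<open>The fourteen terms are sorted by sign, in the order of the two sides of
  \<open>l5_coherence\<close>. A vanishing coboundary is then that axiom, once every element of
  \<open>V\<^sub>1\<close> stands in the last slot of \<open>l3\<close>.\<close>

lemma coboundary_list_form_3: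
  assumes "vector_space t"
  shows "coboundary br t \<rho> 3 (list_form \<Theta>) [(x1, x2), (x3, x4), (x5, x6)] x7 =
    (\<rho> x6 x7 (\<Theta> x1 x2 x3 x4 x5) + \<rho> x7 x5 (\<Theta> x1 x2 x3 x4 x6)
      + \<rho> x1 x2 (\<Theta> x3 x4 x5 x6 x7) + \<rho> x5 x6 (\<Theta> x1 x2 x3 x4 x7)
      + \<Theta> x1 x2 (br x3 x4 x5) x6 x7 + \<Theta> x1 x2 x5 (br x3 x4 x6) x7
      + \<Theta> x1 x2 x5 x6 (br x3 x4 x7))
    - (\<rho> x3 x4 (\<Theta> x1 x2 x5 x6 x7)
      + \<Theta> (br x1 x2 x3) x4 x5 x6 x7 + \<Theta> x3 (br x1 x2 x4) x5 x6 x7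
      + \<Theta> x3 x4 (br x1 x2 x5) x6 x7 + \<Theta> x3 x4 x5 (br x1 x2 x6) x7
      + \<Theta> x1 x2 x3 x4 (br x5 x6 x7) + \<Theta> x3 x4 x5 x6 (br x1 x2 x7))"
proof -
  interpret vector_space t by fact
  have "{1..3::nat} = {1, 2, 3}" "{1..<2::nat} = {1}" "{1..<3::nat} = {1, 2}"
    by auto
  then show ?thesis
    by (simp add: coboundary_def Let_def omit_def numeral_2_eq_2 numeral_3_eq_3 algebra_simps)
qed

section \<open>The direct sum and its semidirect product bracket\<close>

lemma module_prod_scale_vector_space:
  assumes "vector_space s" "vector_space t"
  shows "module_prod.scale s t c (x, y) = (s c x, t c y)"
    and "vector_space (module_prod.scale s t)"
proof -
  interpret s: vector_space s by fact
  interpret t: vector_space t by fact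
  interpret vector_space_prod s t ..
  show "module_prod.scale s t c (x, y) = (s c x, t c y)"
    by (rule scale_prod)
  show "vector_space (module_prod.scale s t)"
    by (rule p.vector_space_axioms)
qed

text \<open>In each term the element of the second summand is rotated into the last slot; cyclic
  permutations of three arguments are even, so no signs occur.\<close>

fun semidirect_bracket ::
  "('a \<Rightarrow> 'a \<Rightarrow> 'a \<Rightarrow> 'a) \<Rightarrow> ('a \<Rightarrow> 'a \<Rightarrow> 'b \<Rightarrow> 'b) \<Rightarrow>
    'a \<times> 'b::ab_group_add \<Rightarrow> 'a \<times> 'b \<Rightarrow> 'a \<times> 'b \<Rightarrow> 'a \<times> 'b"
  where "semidirect_bracket br \<rho> (x, f) (y, g) (z, h) = (br x y z, \<rho> x y h + \<rho> y z f + \<rho> z x g)"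

section \<open>Components of the bracket of a 3-Lie 2-algebra\<close>

context three_lie_2_algebra
begin

lemmas l3_swap = alternating3_swap[OF l3_alternating]
  and l3_add = alternating3_add[OF l3_alternating]
  and l3_scale = alternating3_scale[OF l3_alternating]
  and l3_diag = alternating3_diag[OF l3_alternating]

text \<open>A cyclic permutation is a product of two transpositions, whose signs cancel. Rotations
  carry an element of \<open>V\<^sub>1\<close> from any slot to the last one.\<close>

lemma l3_rotate: "l3 v w u = l3 u v w"
  using l3_swap(2)[of v u w] l3_swap(1)[of u v w] by simp

lemma l010_eq: "l010 x f y = l001 y x f"
  and l100_eq: "l100 f x y = l001 x y f"
  by (simp_all only: l3_rotate[of "(x, 0)" "(0, f)" "(y, 0)"] l3_rotate[of "(x, 0)" "(y, 0)" "(0, f)"])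

text \<open>Splitting each argument as \<open>(x, 0) + (0, f)\<close> gives eight terms: one of
  degree 0, three with a single element of \<open>V\<^sub>1\<close>, which rotate to
  \<open>l001\<close>, and four that vanish. Hence \<open>l3\<close> can be recovered from its
  quadruple.\<close>

lemma l3_eq_semidirect_bracket: "l3 = semidirect_bracket l000 l001"
proof -
  \<comment> \<open>opaque names, as \<open>l000\<close> and \<open>l001\<close> contain the left-hand sides of the rewrite rules below\<close>
  define A B where "A = l000" and "B = l001"
  have "l3 u v w = semidirect_bracket A B u v w" for u v w
  proof -
    obtain x f y g z h where uvw: "u = (x, f)" "v = (y, g)" "w = (z, h)"
      by (meson surj_pair)
    \<comment> \<open>The axiom covers one position of the \<open>V\<^sub>0\<close> argument;
      rotation gives the other two.\<close>
    have deg2: "l3 (0, b) (0, c) (a, 0) = 0" "l3 (0, b) (a, 0) (0, c) = 0"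
      "l3 (a, 0) (0, b) (0, c) = 0" for a b c
      by (simp_all only: l3_rotate[of "(0, b)" "(a, 0)" "(0, c)"] l3_degree2(2)
          l3_rotate[of "(0, c)" "(a, 0)" "(0, b)"] l3_rotate[of "(a, 0)" "(0, b)" "(0, c)"])
    have deg1: "l3 (a, 0) (b, 0) (0, e) = (0, B a b e)" for a b e
      by (simp add: prod_eq_iff l3_degree1 B_def)
    then have deg1': "l3 (a, 0) (0, e) (b, 0) = (0, B b a e)"
      "l3 (0, e) (a, 0) (b, 0) = (0, B a b e)" for a b e
      by (simp_all only: l3_rotate[of "(a, 0)" "(0, e)" "(b, 0)"]
          l3_rotate[of "(a, 0)" "(b, 0)" "(0, e)", symmetric])
    have deg0: "l3 (a, 0) (b, 0) (c, 0) = (A a b c, 0)" for a b c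
      by (simp add: prod_eq_iff l3_degree0 A_def)
    have "l3 u v w = l3 ((x, 0) + (0, f)) ((y, 0) + (0, g)) ((z, 0) + (0, h))"
      by (simp add: uvw)
    also have "\<dots> = (A x y z, B x y h + B y z f + B z x g)"
      by (simp only: l3_add deg0 deg1 deg1' deg2 l3_degree2(1)) (simp add: algebra_simps)
    finally show ?thesis by (simp add: uvw)
  qed
  then show ?thesis 
    unfolding A_def B_def by (intro ext)
qed

lemma l000_alternating: "alternating3 s0 s0 l000"
proof -
  note sc = module_prod_scale_vector_space[OF V0.vector_space_axioms V1.vector_space_axioms]
  \<comment> \<open>Sums and multiples in \<open>V\<^sub>0\<close> become those of the direct sum,
    where trilinearity of \<open>l3\<close> applies; \<open>add_Pair\<close> would undo
    this.\<close>
  have scale: "(s0 c x, 0) = module_prod.scale s0 s1 c (x, 0)" for c x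
    by (simp add: sc)
  have fst_scale: "fst (module_prod.scale s0 s1 c u) = s0 c (fst u)" for c u
    by (cases u) (simp add: sc)
  have add: "(x + y, 0::'b) = (x, 0) + (y, 0)" for x y :: 'a
    by simp
  show ?thesis
    by (simp add: alternating3_def Vector_Spaces.linear_iff V0.vector_space_axioms scale fst_scale
        add l3_add l3_scale l3_diag del: add_Pair)
qed

lemma l001_linear: "Vector_Spaces.linear s1 s1 (l001 x y)"
  and l001_alternating: "alternating2 s0 s1 (\<lambda>x y. l001 x y f)"
proof -
  note sc = module_prod_scale_vector_space[OF V0.vector_space_axioms V1.vector_space_axioms]
  have scale: "(s0 c x, 0) = module_prod.scale s0 s1 c (x, 0)"
    "(0, s1 c g) = module_prod.scale s0 s1 c (0, g)" for c x g
    by (simp_all add: sc)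
  have snd_scale: "snd (module_prod.scale s0 s1 c u) = s1 c (snd u)" for c u
    by (cases u) (simp add: sc)
  have add: "(x + y, 0::'b) = (x, 0) + (y, 0)" "(0::'a, g + h) = (0, g) + (0, h)"
    for x y :: 'a and g h :: 'b
    by simp_all
  show "Vector_Spaces.linear s1 s1 (l001 x y)" "alternating2 s0 s1 (\<lambda>x y. l001 x y f)"
    by (simp_all add: alternating2_def Vector_Spaces.linear_iff V0.vector_space_axioms
        V1.vector_space_axioms scale snd_scale add l3_add l3_scale l3_diag del: add_Pair)
qed

end

section \<open>From skeletal 3-Lie 2-algebras to quadruples\<close>

context skeletal_three_lie_2_algebra
begin

lemmas l5_zero = wedge2_wedge3_map_zero[OF l5_wedge]

lemma l000_three_lie_algebra: "three_lie_algebra s0 l000"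
proof
  show "alternating3 s0 s0 l000"
    by (rule l000_alternating)
  show "l000 x1 x2 (l000 x3 x4 x5) =
    l000 (l000 x1 x2 x3) x4 x5 + l000 x3 (l000 x1 x2 x4) x5 + l000 x3 x4 (l000 x1 x2 x5)"
    for x1 x2 x3 x4 x5
    using d_l5[of x1 x2 x3 x4 x5] by (simp add: skeletal algebra_simps)
qed

lemma l001_three_lie_representation: "three_lie_representation s0 l000 s1 l001"
proof -
  interpret three_lie_algebra s0 l000
    by (rule l000_three_lie_algebra)
  show ?thesis
  proof (intro three_lie_representation.intro three_lie_representation_axioms.intro)
    show "three_lie_algebra s0 l000" "vector_space s1"
      by (rule three_lie_algebra_axioms V1.vector_space_axioms)+
    show "Vector_Spaces.linear s1 s1 (l001 x y)" for x y
      by (rule l001_linear)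
    show "alternating2 s0 s1 (\<lambda>x y. l001 x y v)" for v
      by (rule l001_alternating)
    show "l001 x1 x2 (l001 y1 y2 v) - l001 y1 y2 (l001 x1 x2 v) =
        (\<Sum>(u, w)\<leftarrow>bracket_F l000 (x1, x2) (y1, y2). l001 u w v)" for x1 x2 y1 y2 v
      using l5_d_third[of x1 x2 v y1 y2] by (simp add: skeletal l5_zero l100_eq algebra_simps)
    \<comment> \<open>\<open>l5_d_first\<close> yields a term \<open>l001 y3 y1\<close> where the
      representation condition has \<open>- l001 y1 y3\<close>.\<close>
    have swap: "l001 y x (l001 z w v) = - l001 x y (l001 z w v)" for x y z w v
      by (rule alternating2_swap[OF l001_alternating])
    show "l001 x (l000 y1 y2 y3) v =
        l001 y2 y3 (l001 x y1 v) - l001 y1 y3 (l001 x y2 v) + l001 y1 y2 (l001 x y3 v)"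
      for x y1 y2 y3 v
      using l5_d_first[of v x y1 y2 y3] swap[of y1 y3 x y2 v]
      by (simp add: skeletal l5_zero l100_eq l010_eq algebra_simps)
  qed
qed

lemma l5_three_cocycle: "three_cocycle s0 l000 s1 l001 l5"
  unfolding three_cocycle_def
proof (intro conjI allI)
  show "wedge2_wedge3_map s0 s1 l5"
    by (rule l5_wedge)
  have "coboundary l000 s1 l001 3 (list_form l5) [(x1, x2), (x3, x4), (x5, x6)] z = 0"
    for x1 x2 x3 x4 x5 x6 z
    unfolding coboundary_list_form_3[OF V1.vector_space_axioms] right_minus_eq
    using l5_coherence[of x1 x2 x3 x4 x5 x6 z] by (simp only: l100_eq l010_eq)
  then show "coboundary l000 s1 l001 3 (list_form l5) [X1, X2, X3] z = 0" for X1 X2 X3 z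
    by (cases X1; cases X2; cases X3) (simp only:)
qed

end

section \<open>From quadruples to skeletal 3-Lie 2-algebras\<close>

context three_lie_representation
begin

lemma rho_swap: "\<rho> y x v = - \<rho> x y v"
  by (rule alternating2_swap[OF rho_alternating])

lemma rho_linear:
  "\<rho> (x + x') y v = \<rho> x y v + \<rho> x' y v" "\<rho> (s c x) y v = t c (\<rho> x y v)"
  "\<rho> x (y + y') v = \<rho> x y v + \<rho> x y' v" "\<rho> x (s c y) v = t c (\<rho> x y v)"
  "\<rho> x y (v + v') = \<rho> x y v + \<rho> x y v'" "\<rho> x y (t c v) = t c (\<rho> x y v)"
  using rho_endo rho_alternating by (simp_all add: alternating2_def Vector_Spaces.linear_iff)

lemmas br_add = alternating3_add[OF alternating]
  and br_scale = alternating3_scale[OF alternating]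
  and br_diag = alternating3_diag[OF alternating]

lemma rho_zero: "\<rho> x y 0 = 0" "\<rho> 0 y v = 0" "\<rho> x 0 v = 0"
proof -
  have "Vector_Spaces.linear t t (\<rho> x y)" "Vector_Spaces.linear s t (\<lambda>x. \<rho> x y v)"
    "Vector_Spaces.linear s t (\<lambda>y. \<rho> x y v)"
    using rho_endo rho_alternating by (simp_all add: alternating2_def)
  then show "\<rho> x y 0 = 0" "\<rho> 0 y v = 0" "\<rho> x 0 v = 0"
    by (auto dest: linear_zero)
qed

lemma br_zero: "br 0 y z = 0" "br x 0 z = 0" "br x y 0 = 0"
proof -
  have "Vector_Spaces.linear s s (\<lambda>x. br x y z)" "Vector_Spaces.linear s s (\<lambda>y. br x y z)"
    "Vector_Spaces.linear s s (br x y)"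
    using alternating by (simp_all add: alternating3_def)
  then show "br 0 y z = 0" "br x 0 z = 0" "br x y 0 = 0"
    by (auto dest: linear_zero)
qed

lemma semidirect_bracket_restrict:
  "graded_bracket.l000 (semidirect_bracket br \<rho>) = br"
  "graded_bracket.l001 (semidirect_bracket br \<rho>) = \<rho>"
  by (simp_all add: fun_eq_iff rho_zero)

text \<open>When two arguments coincide, one of the three \<open>\<rho>\<close> terms has the form
  \<open>\<rho> x x v = 0\<close>, and the other two cancel by the sign rule.\<close>

lemma semidirect_bracket_alternating:
  "alternating3 (module_prod.scale s t) (module_prod.scale s t) (semidirect_bracket br \<rho>)"
proof -
  have "\<rho> x x v = 0" "\<rho> x y v + \<rho> y x v = 0" for x y v
    using rho_alternating rho_swap[of x y v] by (simp_all add: alternating2_def)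
  then show ?thesis
    by (simp add: alternating3_def Vector_Spaces.linear_iff br_add br_scale br_diag rho_linear
        module_prod_scale_vector_space[OF vector_space_axioms V.vector_space_axioms]
        V.scale_right_distrib zero_prod_def algebra_simps)
qed

text \<open>The converse construction: \<open>fundamental_identity\<close> yields
  \<open>d_l5\<close>, \<open>rho_bracket\<close> yields \<open>l5_d_first\<close>,
  \<open>rho_commutator\<close> yields \<open>l5_d_third\<close>, and the cocycle condition yields
  \<open>l5_coherence\<close>.\<close>

lemma skeletal_semidirect_bracket:
  assumes "three_cocycle s br t \<rho> \<Theta>"
  shows "skeletal_three_lie_2_algebra t s (\<lambda>_. 0) (semidirect_bracket br \<rho>) \<Theta>"
proof -
  interpret L: graded_bracket "semidirect_bracket br \<rho>" .
  have L: "L.l000 x y z = br x y z" "L.l001 x y f = \<rho> x y f" "L.l010 x f y = \<rho> y x f"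
    "L.l100 f x y = \<rho> x y f" for x y z f
    by (simp_all add: rho_zero)
  have wedge: "wedge2_wedge3_map s t \<Theta>"
    using assms by (simp add: three_cocycle_def)
  have cocycle: "coboundary br t \<rho> 3 (list_form \<Theta>) [(x1, x2), (x3, x4), (x5, x6)] x7 = 0"
    for x1 x2 x3 x4 x5 x6 x7
    using assms unfolding three_cocycle_def by blast
  show ?thesis
  proof (intro skeletal_three_lie_2_algebra.intro three_lie_2_algebra.intro
      three_lie_2_algebra_axioms.intro skeletal_three_lie_2_algebra_axioms.intro)
    show "vector_space t" "vector_space s"
      by (rule vector_space_axioms V.vector_space_axioms)+
    show "Vector_Spaces.linear t s (\<lambda>_. 0)"
      by (simp add: Vector_Spaces.linear_iff vector_space_axioms V.vector_space_axioms)
    show "alternating3 (module_prod.scale s t) (module_prod.scale s t) (semidirect_bracket br \<rho>)"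
      by (rule semidirect_bracket_alternating)
    show "wedge2_wedge3_map s t \<Theta>"
      by (rule wedge)
    show "0 = - L.l000 x1 x2 (L.l000 x3 x4 x5) + L.l000 x3 (L.l000 x1 x2 x4) x5
        + L.l000 (L.l000 x1 x2 x3) x4 x5 + L.l000 x3 x4 (L.l000 x1 x2 x5)" for x1 x2 x3 x4 x5
      unfolding L by (simp add: fundamental_identity[of x1 x2 x3 x4 x5])
    show "\<Theta> 0 x2 x3 x4 x5 = - L.l100 f x2 (L.l000 x3 x4 x5) + L.l010 x3 (L.l100 f x2 x4) x5
        + L.l100 (L.l100 f x2 x3) x4 x5 + L.l001 x3 x4 (L.l100 f x2 x5)" for f x2 x3 x4 x5
      unfolding L by (simp add: wedge2_wedge3_map_zero[OF wedge] rho_bracket rho_swap[of x3 x5])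
    show "\<Theta> x1 x2 0 x4 x5 = - L.l001 x1 x2 (L.l100 f x4 x5) + L.l100 f (L.l000 x1 x2 x4) x5
        + L.l100 (L.l001 x1 x2 f) x4 x5 + L.l100 f x4 (L.l000 x1 x2 x5)" for x1 x2 f x4 x5
      unfolding L using rho_commutator[of x1 x2 x4 x5 f]
      by (simp add: wedge2_wedge3_map_zero[OF wedge] algebra_simps)
    show "L.l100 (\<Theta> x1 x2 x3 x4 x5) x6 x7 + L.l010 x5 (\<Theta> x1 x2 x3 x4 x6) x7
        + L.l001 x1 x2 (\<Theta> x3 x4 x5 x6 x7) + L.l001 x5 x6 (\<Theta> x1 x2 x3 x4 x7)
        + \<Theta> x1 x2 (L.l000 x3 x4 x5) x6 x7 + \<Theta> x1 x2 x5 (L.l000 x3 x4 x6) x7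
        + \<Theta> x1 x2 x5 x6 (L.l000 x3 x4 x7)
      = L.l001 x3 x4 (\<Theta> x1 x2 x5 x6 x7)
        + \<Theta> (L.l000 x1 x2 x3) x4 x5 x6 x7 + \<Theta> x3 (L.l000 x1 x2 x4) x5 x6 x7
        + \<Theta> x3 x4 (L.l000 x1 x2 x5) x6 x7 + \<Theta> x3 x4 x5 (L.l000 x1 x2 x6) x7
        + \<Theta> x1 x2 x3 x4 (L.l000 x5 x6 x7) + \<Theta> x3 x4 x5 x6 (L.l000 x1 x2 x7)"
      for x1 x2 x3 x4 x5 x6 x7
      using cocycle[of x1 x2 x3 x4 x5 x6 x7]
      unfolding L coboundary_list_form_3[OF V.vector_space_axioms] right_minus_eq .
  \<comment> \<open>The degree axioms, \<open>d_l3\<close>, \<open>l3_d\<close> and the trivial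
    \<open>skeletal\<close> remain; all but the last hold because \<open>br\<close> and
    \<open>\<rho>\<close> vanish as soon as one argument is 0.\<close>
  qed (simp_all add: rho_zero br_zero zero_prod_def)
qed

end

theorem theorem5p1:
  shows "bij_betw
    (quadruple_of ::
      ('k::field \<Rightarrow> 'b::ab_group_add \<Rightarrow> 'b) \<times> ('k \<Rightarrow> 'a::ab_group_add \<Rightarrow> 'a) \<times> ('b \<Rightarrow> 'a)
        \<times> ('a \<times> 'b \<Rightarrow> 'a \<times> 'b \<Rightarrow> 'a \<times> 'b \<Rightarrow> 'a \<times> 'b) \<times> ('a \<Rightarrow> 'a \<Rightarrow> 'a \<Rightarrow> 'a \<Rightarrow> 'a \<Rightarrow> 'b) \<Rightarrow> _)
    {(s1, s0, d, l3, l5). skeletal_three_lie_2_algebra s1 s0 d l3 l5}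
    {((s0, br), s1, \<rho>, \<Theta>). three_lie_algebra s0 br \<and> vector_space s1
        \<and> three_lie_representation s0 br s1 \<rho> \<and> three_cocycle s0 br s1 \<rho> \<Theta>}"
    (is "bij_betw _ ?A ?B")
proof (rule bij_betw_byWitness[where
      f' = "\<lambda>((s0, br), s1, \<rho>, \<Theta>). (s1, s0, \<lambda>_. 0, semidirect_bracket br \<rho>, \<Theta>)"])
  \<comment> \<open>The quadruple forgets \<open>d\<close> and keeps only two components of
    \<open>l3\<close>; the former is 0 by \<open>skeletal\<close>, and the latter determine
    \<open>l3\<close>.\<close>
  show "\<forall>a\<in>?A. (\<lambda>((s0, br), s1, \<rho>, \<Theta>). (s1, s0, \<lambda>_. 0, semidirect_bracket br \<rho>, \<Theta>))
      (quadruple_of a) = a"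
    using skeletal_three_lie_2_algebra.skeletal
      three_lie_2_algebra.l3_eq_semidirect_bracket[OF skeletal_three_lie_2_algebra.axioms(1)]
    by (fastforce simp del: semidirect_bracket.simps)
  show "\<forall>b\<in>?B. quadruple_of ((\<lambda>((s0, br), s1, \<rho>, \<Theta>).
      (s1, s0, \<lambda>_. 0, semidirect_bracket br \<rho>, \<Theta>)) b) = b"
    by (auto simp: three_lie_representation.semidirect_bracket_restrict
        simp del: semidirect_bracket.simps)
  show "quadruple_of ` ?A \<subseteq> ?B"
    by (auto simp: skeletal_three_lie_2_algebra.l000_three_lie_algebra
        skeletal_three_lie_2_algebra.l001_three_lie_representation
        skeletal_three_lie_2_algebra.l5_three_cocycle
        intro: three_lie_2_algebra.axioms(1)[OF skeletal_three_lie_2_algebra.axioms(1)])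
  show "(\<lambda>((s0, br), s1, \<rho>, \<Theta>). (s1, s0, \<lambda>_. 0, semidirect_bracket br \<rho>, \<Theta>)) ` ?B \<subseteq> ?A"
    by (auto intro: three_lie_representation.skeletal_semidirect_bracket)
qed

end
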